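(* Let $M$ be a metric space, $X\subseteq M$ a compact subset, and let $k:M\times M\to\mathbb{R}$ be the reproducing kernel of an RKHS $\mathcal{H}$ of complex-valued functions on $M$ such that $k|X\times X$ is continuous and strictly positive-definite. Let $\mathcal{O}=\{x_0,x_1,x_2,\dots\}\subset X$ be a dense, countably infinite set of pairwise distinct points, and let $X_N=\{x_0,\dots,x_{N-1}\}$ denote its first $N$ points. Then the following hold: (i) For every $f\in\mathcal{H}(X)$, $\lim_{N\to\infty}\|T_N(f|X_N)\|_{\mathcal{H}}=\|f\|_{\mathcal{H}}$. (ii) If $f:\mathcal{O}\to\mathbb{C}$ is such that $\|T_N(f|X_N)\|_{\mathcal{H}}$ does not diverge (to $\infty$) as $N\to\infty$, then $f$ has a unique extension in $\mathcal{H}(X)$.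
   Context: Strict positive-definiteness of $k|X\times X$: $\sum_{i,j=1}^n a_i^*a_jk(y_i,y_j)>0$ for all distinct $y_1,\dots,y_n\in X$ and $a_1,\dots,a_n\in\mathbb{C}$ not all zero. $\mathcal{H}(X)$ is the RKHS on $X$ with kernel $k|X\times X$. It embeds isometrically in $\mathcal{H}$ as the closed subspace $\overline{\operatorname{span}}\{k(x,\cdot):x\in X\}$, so its norm is also written $\|\cdot\|_{\mathcal{H}}$. For $g:X_N\to\mathbb{C}$, $T_Ng$ is the unique element $h$ of $\mathcal{H}_N=\operatorname{span}\{k(x_0,\cdot),\dots,k(x_{N-1},\cdot)\}$ with $h(x_n)=g(x_n)$ for all $0\le n\le N-1$. *)

theory Defs
  imports "HOL-Analysis.Analysis" "HOL-Library.Function_Algebras"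
begin

definition fun_scale :: "complex \<Rightarrow> ('a \<Rightarrow> complex) \<Rightarrow> 'a \<Rightarrow> complex" where
  "fun_scale c f = (\<lambda>x. c * f x)"

interpretation fun_space: vector_space fun_scale
  by unfold_locales (auto simp: fun_scale_def fun_eq_iff algebra_simps)

definition ip_norm :: "(('a \<Rightarrow> complex) \<Rightarrow> ('a \<Rightarrow> complex) \<Rightarrow> complex) \<Rightarrow> ('a \<Rightarrow> complex) \<Rightarrow> real" where
  "ip_norm ip f = sqrt (Re (ip f f))"

text \<open>
  A Hilbert space of complex-valued functions on a set \<open>S\<close>, with carrier \<open>H\<close> and inner product
  \<open>ip\<close> (linear in the first, conjugate-linear in the second argument; only its values on
  \<open>H\<close> matter). A function on \<open>S\<close> is represented by its extension by zero to the whole type.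
\<close>

locale hilbert_function_space =
  fixes S :: "'a set"
    and H :: "('a \<Rightarrow> complex) set"
    and ip :: "('a \<Rightarrow> complex) \<Rightarrow> ('a \<Rightarrow> complex) \<Rightarrow> complex"
  assumes zero_outside: "\<And>f x. f \<in> H \<Longrightarrow> x \<notin> S \<Longrightarrow> f x = 0"
    and subspace: "fun_space.subspace H"
    and ip_add_left: "\<And>f g h. f \<in> H \<Longrightarrow> g \<in> H \<Longrightarrow> h \<in> H \<Longrightarrow> ip (f + g) h = ip f h + ip g h"
    and ip_scale_left: "\<And>c f h. f \<in> H \<Longrightarrow> h \<in> H \<Longrightarrow> ip (fun_scale c f) h = c * ip f h"
    and ip_commute: "\<And>f g. f \<in> H \<Longrightarrow> g \<in> H \<Longrightarrow> ip g f = cnj (ip f g)"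
    and ip_nonneg: "\<And>f. f \<in> H \<Longrightarrow> 0 \<le> Re (ip f f)"
    and ip_definite: "\<And>f. f \<in> H \<Longrightarrow> ip f f = 0 \<Longrightarrow> f = 0"
    and complete: "\<And>F :: nat \<Rightarrow> 'a \<Rightarrow> complex.
      range F \<subseteq> H \<Longrightarrow>
      (\<forall>e>0. \<exists>N. \<forall>m\<ge>N. \<forall>n\<ge>N. ip_norm ip (F m - F n) < e) \<Longrightarrow>
      \<exists>f\<in>H. (\<lambda>n. ip_norm ip (F n - f)) \<longlonglongrightarrow> 0"

definition kernel_section :: "'a set \<Rightarrow> ('a \<Rightarrow> 'a \<Rightarrow> real) \<Rightarrow> 'a \<Rightarrow> 'a \<Rightarrow> complex" where
  "kernel_section S k x = (\<lambda>y. if y \<in> S then complex_of_real (k x y) else 0)"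

text \<open>
  Only the values of \<open>k\<close> on \<open>S \<times> S\<close> enter, so \<open>rkhs X H ip k\<close> for a kernel \<open>k\<close> given on a
  larger set says that \<open>(H, ip)\<close> is the RKHS on \<open>X\<close> with kernel the restriction of \<open>k\<close> to
  \<open>X \<times> X\<close>.
\<close>

locale rkhs = hilbert_function_space S H ip
  for S :: "'a set"
    and H :: "('a \<Rightarrow> complex) set"
    and ip :: "('a \<Rightarrow> complex) \<Rightarrow> ('a \<Rightarrow> complex) \<Rightarrow> complex" +
  fixes k :: "'a \<Rightarrow> 'a \<Rightarrow> real"
  assumes section_mem: "\<And>x. x \<in> S \<Longrightarrow> kernel_section S k x \<in> H"
    and reproducing: "\<And>f x. f \<in> H \<Longrightarrow> x \<in> S \<Longrightarrow> f x = ip f (kernel_section S k x)"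

definition strictly_pos_def_on :: "'a set \<Rightarrow> ('a \<Rightarrow> 'a \<Rightarrow> real) \<Rightarrow> bool" where
  "strictly_pos_def_on X k \<longleftrightarrow>
    (\<forall>(n::nat) (y :: nat \<Rightarrow> 'a) (a :: nat \<Rightarrow> complex).
      inj_on y {..<n} \<longrightarrow> y ` {..<n} \<subseteq> X \<longrightarrow> (\<exists>i<n. a i \<noteq> 0) \<longrightarrow>
      (let q = (\<Sum>i<n. \<Sum>j<n. cnj (a i) * a j * complex_of_real (k (y i) (y j)))
       in q \<in> \<real> \<and> 0 < Re q))"

text \<open>
  The element of the span of the sections \<open>k(y, \<cdot>)\<close>, \<open>y \<in> Y\<close> (functions on the whole type),
  that interpolates \<open>g\<close> on \<open>Y\<close>. It exists and is unique for finite \<open>Y\<close> if \<open>k\<close> is strictly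
  positive-definite on \<open>Y\<close>. Values of \<open>g\<close> outside \<open>Y\<close> are irrelevant.
\<close>

definition interpolant :: "('a \<Rightarrow> 'a \<Rightarrow> real) \<Rightarrow> 'a set \<Rightarrow> ('a \<Rightarrow> complex) \<Rightarrow> 'a \<Rightarrow> complex" where
  "interpolant k Y g =
    (THE h. h \<in> fun_space.span (kernel_section UNIV k ` Y) \<and> (\<forall>y\<in>Y. h y = g y))"

end

theory Submission
  imports Defs
begin

text \<open>
  The interpolant \<open>P\<^sub>N\<close> of \<open>f\<close> on the first \<open>N\<close> points is orthogonal to every function of the
  RKHS that vanishes there, so \<open>\<parallel>h\<parallel>\<^sup>2 = \<parallel>P\<^sub>N\<parallel>\<^sup>2 + \<parallel>h - P\<^sub>N\<parallel>\<^sup>2\<close> for every \<open>h\<close> that agrees with \<open>f\<close> on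
  these points. With \<open>h = P\<^sub>M\<close>, \<open>M \<ge> N\<close>, the norms increase, and if they are bounded then \<open>(P\<^sub>N)\<close>
  is Cauchy; its limit agrees with \<open>f\<close> on all points, because point evaluations are continuous.
  Functions in the RKHS on \<open>X\<close> are continuous, hence determined by their values on a dense set.
\<close>

section \<open>Geometry of the inner product\<close>

context hilbert_function_space
begin

lemma zero_mem: "0 \<in> H"
  using fun_space.subspace_0[OF subspace] .

lemma add_mem: "f \<in> H \<Longrightarrow> g \<in> H \<Longrightarrow> f + g \<in> H"
  using fun_space.subspace_add[OF subspace] .

lemma diff_mem: "f \<in> H \<Longrightarrow> g \<in> H \<Longrightarrow> f - g \<in> H"
  using fun_space.subspace_diff[OF subspace] .

lemma scale_mem: "f \<in> H \<Longrightarrow> fun_scale c f \<in> H"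
  using fun_space.subspace_scale[OF subspace] .

lemma ip_zero_left: "h \<in> H \<Longrightarrow> ip 0 h = 0"
  using ip_add_left[of 0 0 h] zero_mem by simp

lemma ip_zero_right: "h \<in> H \<Longrightarrow> ip h 0 = 0"
  using ip_commute[of 0 h] zero_mem ip_zero_left by simp

lemma ip_diff_left:
  assumes "f \<in> H" "g \<in> H" "h \<in> H"
  shows "ip (f - g) h = ip f h - ip g h"
  using ip_add_left[of "f - g" g h] assms diff_mem by simp

lemma ip_add_right:
  assumes "f \<in> H" "g \<in> H" "h \<in> H"
  shows "ip h (f + g) = ip h f + ip h g"
  using assms ip_add_left[of f g h] ip_commute[of "f + g" h] ip_commute[of f h]
    ip_commute[of g h] add_mem by simp

lemma ip_diff_right:
  assumes "f \<in> H" "g \<in> H" "h \<in> H"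
  shows "ip h (f - g) = ip h f - ip h g"
  using ip_add_right[of "f - g" g h] assms diff_mem by simp

lemma ip_scale_right:
  assumes "f \<in> H" "h \<in> H"
  shows "ip h (fun_scale c f) = cnj c * ip h f"
  using assms ip_scale_left[of f h c] ip_commute[of "fun_scale c f" h] ip_commute[of f h]
    scale_mem by simp

lemma ip_norm_nonneg: "f \<in> H \<Longrightarrow> 0 \<le> ip_norm ip f"
  by (simp add: ip_norm_def ip_nonneg)

lemma ip_self:
  assumes "f \<in> H"
  shows "ip f f = complex_of_real ((ip_norm ip f)\<^sup>2)"
proof -
  have "Im (ip f f) = 0"
    using arg_cong[OF ip_commute[OF assms assms], of Im] by simp
  then show ?thesis
    using ip_nonneg[OF assms] by (simp add: ip_norm_def complex_eq_iff)
qed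

lemma ip_norm_eq_0: "f \<in> H \<Longrightarrow> ip_norm ip f = 0 \<Longrightarrow> f = 0"
  using ip_definite ip_self by simp

lemma Cauchy_Schwarz:
  assumes f: "f \<in> H" and g: "g \<in> H"
  shows "cmod (ip f g) \<le> ip_norm ip f * ip_norm ip g"
proof (cases "ip_norm ip g = 0")
  case True
  then show ?thesis
    using ip_norm_eq_0[OF g] ip_zero_right[OF f] by simp
next
  case False
  define n where "n = (ip_norm ip g)\<^sup>2"
  \<comment> \<open>\<open>fun_scale c g\<close> is the orthogonal projection of \<open>f\<close>
    onto the line through \<open>g\<close>; the nonnegative squared norm of the remainder yields the
    inequality.\<close>
  define c where "c = ip f g / complex_of_real n"
  have n: "n > 0"
    using False by (simp add: n_def)
  have u: "fun_scale c g \<in> H"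
    using scale_mem g by simp
  have "ip (f - fun_scale c g) (f - fun_scale c g)
      = ip f f - cnj c * ip f g - c * cnj (ip f g) + c * cnj c * ip g g"
    using f g u ip_commute[OF f g]
    by (simp add: ip_diff_left ip_diff_right diff_mem ip_scale_left ip_scale_right algebra_simps)
  also have "\<dots> = complex_of_real ((ip_norm ip f)\<^sup>2 - (cmod (ip f g))\<^sup>2 / n)"
    using n by (simp add: ip_self[OF f] ip_self[OF g] c_def n_def[symmetric] complex_norm_square[unfolded of_real_power]
        field_simps)
  finally have "0 \<le> (ip_norm ip f)\<^sup>2 - (cmod (ip f g))\<^sup>2 / n"
    using ip_nonneg[OF diff_mem[OF f u]] by simp
  then have "(cmod (ip f g))\<^sup>2 \<le> (ip_norm ip f * ip_norm ip g)\<^sup>2"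
    using n by (simp add: field_simps n_def power_mult_distrib)
  then show ?thesis
    by (rule power2_le_imp_le) (simp add: f g ip_norm_nonneg)
qed

text \<open>The hypothesis \<open>hp\<close> says that \<open>h - p\<close> is orthogonal to
  \<open>p\<close>.\<close>

lemma ip_norm_Pythagoras:
  assumes h: "h \<in> H" and p: "p \<in> H" and hp: "ip h p = ip p p"
  shows "(ip_norm ip h)\<^sup>2 = (ip_norm ip p)\<^sup>2 + (ip_norm ip (h - p))\<^sup>2"
proof -
  have "ip p h = ip p p"
    using ip_commute[OF h p] ip_commute[OF p p] hp by simp
  then have "ip (h - p) (h - p) = ip h h - ip p p"
    using h p hp by (simp add: ip_diff_left ip_diff_right diff_mem)
  then have "complex_of_real ((ip_norm ip (h - p))\<^sup>2)
      = complex_of_real ((ip_norm ip h)\<^sup>2 - (ip_norm ip p)\<^sup>2)"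
    using h p by (simp add: ip_self diff_mem)
  then show ?thesis
    unfolding of_real_eq_iff by simp
qed

end

section \<open>Kernel combinations and solvability of the interpolation problem\<close>

text \<open>The set \<open>S\<close> is a parameter so that one coefficient vector can be read both
  on the whole space and on the compact subset.\<close>

definition kernel_comb ::
    "'a set \<Rightarrow> ('a \<Rightarrow> 'a \<Rightarrow> real) \<Rightarrow> (nat \<Rightarrow> 'a) \<Rightarrow> nat \<Rightarrow> (nat \<Rightarrow> complex) \<Rightarrow> 'a \<Rightarrow> complex" where
  "kernel_comb S k x N a = (\<Sum>i<N. fun_scale (a i) (kernel_section S k (x i)))"

lemma kernel_comb_0 [simp]: "kernel_comb S k x 0 a = 0"
  by (simp add: kernel_comb_def)

lemma kernel_comb_Suc [simp]:
  "kernel_comb S k x (Suc N) a = kernel_comb S k x N a + fun_scale (a N) (kernel_section S k (x N))"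
  by (simp add: kernel_comb_def)

lemma kernel_comb_apply:
  "t \<in> S \<Longrightarrow> kernel_comb S k x N a t = (\<Sum>i<N. a i * complex_of_real (k (x i) t))"
  by (induction N) (auto simp: fun_scale_def kernel_section_def)

lemma span_kernel_sectionsD:
  assumes "h \<in> fun_space.span (kernel_section S k ` x ` {..<N})"
  shows "\<exists>a. h = kernel_comb S k x N a"
  using assms
proof (induction N arbitrary: h)
  case 0
  then show ?case by simp
next
  case (Suc N)
  then obtain c where
    "h - fun_scale c (kernel_section S k (x N)) \<in> fun_space.span (kernel_section S k ` x ` {..<N})"
    by (auto simp: lessThan_Suc fun_space.span_breakdown_eq)
  with Suc.IH obtain a where
    a: "h - fun_scale c (kernel_section S k (x N)) = kernel_comb S k x N a"
    by blast
  have "kernel_comb S k x N (a(N := c)) = kernel_comb S k x N a"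
    by (simp add: kernel_comb_def)
  then have "h = kernel_comb S k x (Suc N) (a(N := c))"
    using a by (simp add: algebra_simps)
  then show ?case by blast
qed

lemma kernel_comb_in_span:
  "kernel_comb S k x N a \<in> fun_space.span (kernel_section S k ` x ` {..<N})"
  unfolding kernel_comb_def
  by (intro fun_space.span_sum fun_space.span_scale fun_space.span_base) auto

text \<open>Induction by bordering: a solution for \<open>N\<close> points is corrected by a
  multiple of a combination that vanishes at these points but not at the next one.\<close>

lemma interpolation_coeffs_exist:
  fixes k :: "'a \<Rightarrow> 'a \<Rightarrow> real" and x :: "nat \<Rightarrow> 'a"
  assumes spd: "strictly_pos_def_on X k" and "inj_on x {..<N}" and "x ` {..<N} \<subseteq> X"
  shows "\<exists>a. \<forall>i<N. (\<Sum>j<N. a j * complex_of_real (k (x j) (x i))) = g i"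
  using assms(2,3)
proof (induction N arbitrary: g)
  case 0
  then show ?case by simp
next
  case (Suc N)
  let ?K = "\<lambda>j i. complex_of_real (k (x j) (x i))"
  have "inj_on x {..<N}" "x ` {..<N} \<subseteq> X"
    using Suc.prems by (auto intro: inj_on_subset)
  note IH = Suc.IH[OF this]
  obtain a where a: "\<And>i. i < N \<Longrightarrow> (\<Sum>j<N. a j * ?K j i) = g i"
    using IH by blast
  \<comment> \<open>\<open>b\<close> interpolates the section at \<open>x N\<close> on the earlier
    points; \<open>c\<close> then holds the coefficients of that section minus its
    interpolant.\<close>
  obtain b where b: "\<And>i. i < N \<Longrightarrow> (\<Sum>j<N. b j * ?K j i) = ?K N i"
    using IH[of "\<lambda>i. ?K N i"] by blast
  define c where "c = (\<lambda>j. if j = N then 1 else - b j)"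
  define u where "u = (\<lambda>i. \<Sum>j<Suc N. c j * ?K j i)"
  have u0: "u i = 0" if "i < N" for i
    using b[OF that] by (simp add: u_def c_def sum_negf)
  \<comment> \<open>\<open>u\<close> vanishes at the first \<open>N\<close> points, so its value at the last one is the quadratic form of \<open>c\<close>.\<close>
  have "(\<Sum>i<Suc N. \<Sum>j<Suc N. cnj (cnj (c i)) * cnj (c j) * ?K i j)
      = (\<Sum>j<Suc N. \<Sum>i<Suc N. cnj (c j) * (c i * ?K i j))"
    by (subst sum.swap) (simp only: complex_cnj_cnj mult_ac)
  also have "\<dots> = (\<Sum>j<Suc N. cnj (c j) * u j)"
    by (simp only: u_def sum_distrib_left)
  also have "\<dots> = u N"
    using u0 by (simp add: c_def)
  finally have q: "(\<Sum>i<Suc N. \<Sum>j<Suc N. cnj (cnj (c i)) * cnj (c j) * ?K i j) = u N" .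
  have "\<exists>i<Suc N. cnj (c i) \<noteq> 0"
    by (rule exI[of _ N]) (simp add: c_def)
  \<comment> \<open>The definition of positivity conjugates the coefficient at the first kernel
    argument, whereas \<open>u\<close> has \<open>c\<close> there unconjugated; hence the instance
    \<open>cnj (c i)\<close>.\<close>
  then have "0 < Re (u N)"
    using spd[unfolded strictly_pos_def_on_def Let_def, rule_format, of x "Suc N" "\<lambda>i. cnj (c i)"]
      Suc.prems unfolding q by blast
  then have uN: "u N \<noteq> 0"
    by auto
  \<comment> \<open>The induction hypothesis leaves \<open>a N\<close> arbitrary; the value 0
    preserves the first \<open>N\<close> equations, and \<open>d\<close> removes the residual at
    \<open>x N\<close>.\<close>
  define a' where "a' = a(N := 0)"
  define d where "d = (g N - (\<Sum>j<Suc N. a' j * ?K j N)) / u N"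
  have "(\<Sum>j<Suc N. (a' j + d * c j) * ?K j i) = g i" if "i < Suc N" for i
  proof -
    have "(\<Sum>j<Suc N. (a' j + d * c j) * ?K j i) = (\<Sum>j<Suc N. a' j * ?K j i) + d * u i"
      unfolding u_def sum_distrib_left sum.distrib[symmetric] by (simp only: algebra_simps)
    moreover have "(\<Sum>j<Suc N. a' j * ?K j i) = g i" if "i < N"
      using a[OF that] by (simp add: a'_def)
    moreover have "d * u N = g N - (\<Sum>j<Suc N. a' j * ?K j N)"
      using uN by (simp add: d_def)
    ultimately show ?thesis
      using u0 that by (cases "i = N") (simp_all del: sum.lessThan_Suc)
  qed
  then show ?case
    by (intro exI[of _ "\<lambda>j. a' j + d * c j"] allI impI)
qed

section \<open>Consequences of the reproducing property\<close>

context rkhs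
begin

lemma kernel_comb_mem:
  "(\<And>i. i < N \<Longrightarrow> x i \<in> S) \<Longrightarrow> kernel_comb S k x N a \<in> H"
  by (induction N) (simp_all add: zero_mem add_mem scale_mem section_mem)

lemma ip_kernel_comb:
  assumes "f \<in> H" and "\<And>i. i < N \<Longrightarrow> x i \<in> S"
  shows "ip f (kernel_comb S k x N a) = (\<Sum>i<N. cnj (a i) * f (x i))"
  using assms(2)
  by (induction N)
    (simp_all add: assms(1) ip_zero_right ip_add_right ip_scale_right kernel_comb_mem scale_mem
      section_mem reproducing[symmetric])

text \<open>The right-hand side involves only kernel values at the nodes, which allows norms in
  RKHSs on different sets to be compared.\<close>

lemma ip_kernel_comb_self:
  assumes "\<And>i. i < N \<Longrightarrow> x i \<in> S"
  shows "ip (kernel_comb S k x N a) (kernel_comb S k x N a)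
    = (\<Sum>i<N. cnj (a i) * (\<Sum>j<N. a j * complex_of_real (k (x j) (x i))))"
  using assms by (simp add: ip_kernel_comb kernel_comb_mem kernel_comb_apply)

text \<open>A kernel combination tests functions only at its nodes. This is the orthogonality behind
  both the Pythagorean identity and the uniqueness of interpolants.\<close>

lemma ip_kernel_comb_cong:
  assumes "f \<in> H" "g \<in> H" "\<And>i. i < N \<Longrightarrow> x i \<in> S" "\<And>i. i < N \<Longrightarrow> f (x i) = g (x i)"
  shows "ip f (kernel_comb S k x N a) = ip g (kernel_comb S k x N a)"
  using assms by (simp add: ip_kernel_comb)

lemma interpolant_eq_kernel_comb:
  assumes S: "S = UNIV"
    and a: "\<And>i. i < N \<Longrightarrow> kernel_comb S k x N a (x i) = f (x i)"
  shows "interpolant k (x ` {..<N}) f = kernel_comb S k x N a"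
  unfolding interpolant_def
proof (rule the_equality)
  show "kernel_comb S k x N a \<in> fun_space.span (kernel_section UNIV k ` x ` {..<N})
      \<and> (\<forall>y\<in>x ` {..<N}. kernel_comb S k x N a y = f y)"
    using a kernel_comb_in_span[of S k x N a] S by auto
next
  fix h
  assume h: "h \<in> fun_space.span (kernel_section UNIV k ` x ` {..<N}) \<and> (\<forall>y\<in>x ` {..<N}. h y = f y)"
  then obtain b where b: "h = kernel_comb S k x N b"
    using span_kernel_sectionsD S by blast
  let ?p = "kernel_comb S k x N a"
  have mem: "h \<in> H" "?p \<in> H"
    using b kernel_comb_mem[of N x] S by auto
  have eq: "h (x i) = ?p (x i)" if "i < N" for i
    using h a that by auto
  \<comment> \<open>Both \<open>h\<close> and \<open>?p\<close> are kernel combinations with the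
    same nodal values, so their difference is orthogonal to each of them and hence to
    itself.\<close>
  have "ip h h = ip ?p h" "ip h ?p = ip ?p ?p"
    using ip_kernel_comb_cong[OF mem] eq b S by auto
  then have "ip (h - ?p) (h - ?p) = 0"
    using mem by (simp add: ip_diff_left ip_diff_right diff_mem)
  then show "h = ?p"
    using ip_definite diff_mem mem by fastforce
qed

text \<open>Cauchy-Schwarz against the kernel section; used to pass from norm convergence to
  pointwise convergence.\<close>

lemma eval_bound:
  assumes "f \<in> H" "t \<in> S"
  shows "cmod (f t) \<le> ip_norm ip f * ip_norm ip (kernel_section S k t)"
  using Cauchy_Schwarz[OF assms(1) section_mem[OF assms(2)]] reproducing[OF assms] by simp

lemma section_dist:
  assumes s: "s \<in> S" and t: "t \<in> S"
  shows "ip_norm ip (kernel_section S k s - kernel_section S k t)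
    = sqrt (k s s - k s t - k t s + k t t)"
proof -
  have ips: "ip (kernel_section S k a) (kernel_section S k b) = complex_of_real (k a b)"
    if "a \<in> S" "b \<in> S" for a b
    using reproducing[OF section_mem[OF that(1)] that(2)] that by (simp add: kernel_section_def)
  show ?thesis
    unfolding ip_norm_def
    using s t by (simp add: ip_diff_left ip_diff_right diff_mem section_mem ips)
qed

end

section \<open>Continuity and determination by dense subsets\<close>

text \<open>The increment of \<open>f\<close> is its inner product with a difference of two
  sections, whose norm tends to 0 by continuity of the kernel.\<close>

lemma rkhs_mem_continuous:
  fixes S :: "'a::topological_space set"
  assumes "rkhs S H ip k" and f: "f \<in> H" and k: "continuous_on (S \<times> S) (\<lambda>(s, t). k s t)"
  shows "continuous_on S f"
  unfolding continuous_on_def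
proof
  interpret rkhs S H ip k by fact
  fix s assume s: "s \<in> S"
  \<comment> \<open>The Cauchy-Schwarz bound with the distance of the sections written out through
    \<open>k\<close>, so that it is visibly continuous in \<open>t\<close> and zero at
    \<open>t = s\<close>.\<close>
  define \<delta> where "\<delta> = (\<lambda>t. ip_norm ip f * sqrt (k t t - k t s - k s t + k s s))"
  have "continuous_on S (\<lambda>t. k t t)" "continuous_on S (\<lambda>t. k t s)" "continuous_on S (\<lambda>t. k s t)"
    using s by (auto intro!: continuous_on_compose2[OF k, of S "\<lambda>t. (t, t)", simplified]
      continuous_on_compose2[OF k, of S "\<lambda>t. (t, s)", simplified]
      continuous_on_compose2[OF k, of S "\<lambda>t. (s, t)", simplified] continuous_intros)
  then have "continuous_on S \<delta>"
    unfolding \<delta>_def by (intro continuous_intros)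
  then have "(\<delta> \<longlongrightarrow> \<delta> s) (at s within S)"
    using s by (simp add: continuous_on_def)
  then have lim: "(\<delta> \<longlongrightarrow> 0) (at s within S)"
    by (simp add: \<delta>_def)
  have bound: "cmod (f t - f s) \<le> \<delta> t" if "t \<in> S" for t
  proof -
    have "f t - f s = ip f (kernel_section S k t - kernel_section S k s)"
      using f s that by (simp add: ip_diff_right section_mem reproducing[symmetric])
    then show ?thesis
      using Cauchy_Schwarz[OF f diff_mem[OF section_mem[OF that] section_mem[OF s]]]
      by (simp add: \<delta>_def section_dist that s)
  qed
  have "((\<lambda>t. f t - f s) \<longlongrightarrow> 0) (at s within S)"
    by (rule Lim_null_comparison[OF _ lim]) (auto simp: eventually_at_filter bound)
  then show "(f \<longlongrightarrow> f s) (at s within S)"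
    by (simp add: LIM_zero_iff)
qed

lemma rkhs_eq_if_eq_on_dense:
  fixes S :: "'a::topological_space set"
  assumes "rkhs S H ip k" and mem: "f \<in> H" "g \<in> H" and k: "continuous_on (S \<times> S) (\<lambda>(s, t). k s t)"
    and "closed S" and D: "D \<subseteq> S" "S \<subseteq> closure D" and eq: "\<And>t. t \<in> D \<Longrightarrow> f t = g t"
  shows "f = g"
proof -
  interpret rkhs S H ip k by fact
  have S: "closure D = S"
    using D \<open>closed S\<close> closure_minimal by blast
  have "continuous_on (closure D) (\<lambda>t. f t - g t)"
    unfolding S using mem by (intro continuous_intros rkhs_mem_continuous[OF assms(1) _ k])
  then have "f t - g t = 0" if "t \<in> S" for t
    by (rule continuous_constant_on_closure) (use eq that S in auto)
  \<comment> \<open>Off \<open>S\<close> the equality comes from the convention of extension by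
    zero.\<close>
  moreover have "f t = g t" if "t \<notin> S" for t
    using mem that by (simp add: zero_outside)
  ultimately show ?thesis
    by (metis eq_iff_diff_eq_0 ext)
qed

section \<open>Monotonicity and convergence of the interpolants\<close>

text \<open>Fixes interpolating coefficients for every \<open>N\<close>. The data \<open>f\<close>
  may be any function, so that both claims are covered.\<close>

locale kernel_interpolation = rkhs S H ip k
  for S :: "'a set" and H ip k +
  fixes x :: "nat \<Rightarrow> 'a" and f :: "'a \<Rightarrow> complex" and a :: "nat \<Rightarrow> nat \<Rightarrow> complex"
  assumes x_mem: "x i \<in> S"
    and interpolates: "i < N \<Longrightarrow> kernel_comb S k x N (a N) (x i) = f (x i)"
begin

abbreviation P :: "nat \<Rightarrow> 'a \<Rightarrow> complex" where
  "P N \<equiv> kernel_comb S k x N (a N)"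

lemma P_mem: "P N \<in> H"
  by (simp add: kernel_comb_mem x_mem)

lemma norm_decomp:
  assumes "h \<in> H" "\<And>i. i < N \<Longrightarrow> h (x i) = f (x i)"
  shows "(ip_norm ip h)\<^sup>2 = (ip_norm ip (P N))\<^sup>2 + (ip_norm ip (h - P N))\<^sup>2"
  using assms P_mem x_mem interpolates by (intro ip_norm_Pythagoras ip_kernel_comb_cong) auto

lemma norm_decomp_le:
  assumes "N \<le> M"
  shows "(ip_norm ip (P M))\<^sup>2 = (ip_norm ip (P N))\<^sup>2 + (ip_norm ip (P M - P N))\<^sup>2"
  using assms by (intro norm_decomp P_mem interpolates) simp

lemma norm_incseq: "incseq (\<lambda>N. ip_norm ip (P N))"
proof (rule monoI)
  fix N M :: nat
  assume "N \<le> M"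
  then show "ip_norm ip (P N) \<le> ip_norm ip (P M)"
    by (intro power2_le_imp_le[OF _ ip_norm_nonneg[OF P_mem]]) (simp add: norm_decomp_le[of N M])
qed

lemma norm_le:
  assumes "h \<in> H" "\<And>i. h (x i) = f (x i)"
  shows "ip_norm ip (P N) \<le> ip_norm ip h"
proof (rule power2_le_imp_le)
  show "(ip_norm ip (P N))\<^sup>2 \<le> (ip_norm ip h)\<^sup>2"
    using norm_decomp[of h N] assms by simp
qed (rule ip_norm_nonneg[OF assms(1)])

text \<open>Common core of both claims: the bound comes from the norm of a given function in (i) and
  from non-divergence in (ii).\<close>

lemma limit_exists:
  assumes bdd: "\<And>N. ip_norm ip (P N) \<le> B"
  shows "\<exists>g\<in>H. (\<forall>n. g (x n) = f (x n)) \<and> (\<lambda>N. ip_norm ip (P N)) \<longlonglongrightarrow> ip_norm ip g"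
proof -
  obtain L where "(\<lambda>N. ip_norm ip (P N)) \<longlonglongrightarrow> L"
    by (rule incseq_convergent[OF norm_incseq, of B]) (use bdd in auto)
  \<comment> \<open>Squares are needed because \<open>norm_decomp_le\<close> turns their differences
    into squared distances of interpolants.\<close>
  then have "Cauchy (\<lambda>N. (ip_norm ip (P N))\<^sup>2)"
    by (rule LIMSEQ_imp_Cauchy[OF tendsto_power])
  have "\<exists>N0. \<forall>m\<ge>N0. \<forall>n\<ge>N0. ip_norm ip (P m - P n) < e" if e: "e > 0" for e
  proof -
    from e have "e\<^sup>2 > 0" by simp
    then obtain N0 where
      N0: "\<And>m n. m \<ge> N0 \<Longrightarrow> n \<ge> N0 \<Longrightarrow> \<bar>(ip_norm ip (P m))\<^sup>2 - (ip_norm ip (P n))\<^sup>2\<bar> < e\<^sup>2"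
      using metric_CauchyD[OF \<open>Cauchy _\<close>, of "e\<^sup>2"] unfolding dist_real_def by auto
    have ordered: "ip_norm ip (P m - P n) < e" if "n \<ge> N0" "n \<le> m" for m n
    proof (rule power2_less_imp_less)
      show "(ip_norm ip (P m - P n))\<^sup>2 < e\<^sup>2"
        using N0[of m n] norm_decomp_le[OF that(2)] that by linarith
    qed (use e in simp)
    have "ip_norm ip (P m - P n) = ip_norm ip (P n - P m)" for m n
      by (simp add: ip_norm_def ip_diff_left ip_diff_right diff_mem P_mem)
    then have "ip_norm ip (P m - P n) < e" if "m \<ge> N0" "n \<ge> N0" for m n
      using ordered that by (metis nle_le)
    then show ?thesis by blast
  qed
  then obtain g where g: "g \<in> H" and lim: "(\<lambda>N. ip_norm ip (P N - g)) \<longlonglongrightarrow> 0"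
    using complete[of P] P_mem by blast
  have eq: "g (x n) = f (x n)" for n
  proof -
    have "(\<lambda>N. P N (x n) - g (x n)) \<longlonglongrightarrow> 0"
    proof (rule Lim_null_comparison)
      show "(\<lambda>N. ip_norm ip (P N - g) * ip_norm ip (kernel_section S k (x n))) \<longlonglongrightarrow> 0"
        using lim by (rule tendsto_mult_left_zero)
      show "\<forall>\<^sub>F N in sequentially. cmod (P N (x n) - g (x n))
          \<le> ip_norm ip (P N - g) * ip_norm ip (kernel_section S k (x n))"
        using eval_bound[OF diff_mem[OF P_mem g] x_mem] by simp
    qed
    \<comment> \<open>Once \<open>N > n\<close>, the point \<open>x n\<close> is among the nodes and
      the value of \<open>P N\<close> there is fixed.\<close>
    moreover have "\<forall>\<^sub>F N in sequentially. P N (x n) - g (x n) = f (x n) - g (x n)"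
      using eventually_gt_at_top[of n] by eventually_elim (simp add: interpolates)
    ultimately have "(\<lambda>N. f (x n) - g (x n)) \<longlonglongrightarrow> 0"
      by (rule Lim_transform_eventually)
    then show ?thesis
      by (simp add: LIMSEQ_const_iff)
  qed
  have "ip_norm ip (g - P N) = ip_norm ip (P N - g)" for N
    using g by (simp add: ip_norm_def ip_diff_left ip_diff_right diff_mem P_mem)
  \<comment> \<open>The limit \<open>g\<close> interpolates as well, so the Pythagorean identity
    gives convergence of the norms.\<close>
  then have sq: "(ip_norm ip (P N))\<^sup>2 = (ip_norm ip g)\<^sup>2 - (ip_norm ip (P N - g))\<^sup>2" for N
    using norm_decomp[OF g, of N] eq by simp
  have "(\<lambda>N. sqrt ((ip_norm ip g)\<^sup>2 - (ip_norm ip (P N - g))\<^sup>2))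
      \<longlonglongrightarrow> sqrt ((ip_norm ip g)\<^sup>2 - 0\<^sup>2)"
    by (intro tendsto_intros lim)
  then have "(\<lambda>N. ip_norm ip (P N)) \<longlonglongrightarrow> ip_norm ip g"
    using g by (simp add: sq[symmetric] ip_norm_nonneg P_mem)
  with g eq show ?thesis by blast
qed

end

section \<open>Transfer between the two spaces and proof of both claims\<close>

theorem theorem3:
  fixes X :: "'a::metric_space set"
    and k :: "'a \<Rightarrow> 'a \<Rightarrow> real"
    and H HX :: "('a \<Rightarrow> complex) set"
    and ip ipX :: "('a \<Rightarrow> complex) \<Rightarrow> ('a \<Rightarrow> complex) \<Rightarrow> complex"
    and x :: "nat \<Rightarrow> 'a"
  assumes "compact X"
    and "rkhs UNIV H ip k"
    and "continuous_on (X \<times> X) (\<lambda>(s, t). k s t)"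
    and "strictly_pos_def_on X k"
    and "rkhs X HX ipX k"
    and "inj x"
    and "range x \<subseteq> X"
    and "X \<subseteq> closure (range x)"
  shows "(\<forall>f\<in>HX. (\<lambda>N. ip_norm ip (interpolant k (x ` {..<N}) f)) \<longlonglongrightarrow> ip_norm ipX f)
    \<and> (\<forall>f :: 'a \<Rightarrow> complex.
         \<not> filterlim (\<lambda>N. ip_norm ip (interpolant k (x ` {..<N}) f)) at_top sequentially \<longrightarrow>
         (\<exists>!g. g \<in> HX \<and> (\<forall>n. g (x n) = f (x n))))"
proof -
  interpret M: rkhs UNIV H ip k by fact
  interpret X: rkhs X HX ipX k by fact
  have x_mem: "x i \<in> X" for i
    using assms(7) by auto
  \<comment> \<open>Both squared norms are the same quadratic form in kernel values at the nodes:
    the isometric embedding of \<open>HX\<close> into \<open>H\<close>, restricted to kernel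
    combinations.\<close>
  have norm_eq: "ip_norm ip (kernel_comb UNIV k x N a) = ip_norm ipX (kernel_comb X k x N a)" for N a
    by (simp add: ip_norm_def M.ip_kernel_comb_self X.ip_kernel_comb_self x_mem)
  have unique: "g = h" if "g \<in> HX" "h \<in> HX" "\<And>n. g (x n) = h (x n)" for g h
    using rkhs_eq_if_eq_on_dense[OF assms(5) that(1,2) assms(3)
      compact_imp_closed[OF assms(1)] assms(7,8)] that(3)
    by blast
  \<comment> \<open>The nodes lie in \<open>X\<close>, so one choice of coefficients interpolates in
    both spaces, and the limit arguments can take place in \<open>HX\<close>.\<close>
  have coeffs: "\<exists>a. kernel_interpolation X HX ipX k x f a
      \<and> (\<forall>N. ip_norm ip (interpolant k (x ` {..<N}) f) = ip_norm ipX (kernel_comb X k x N (a N)))" for f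
  proof -
    have "\<exists>a. \<forall>i<N. (\<Sum>j<N. a j * complex_of_real (k (x j) (x i))) = f (x i)" for N
      using x_mem by (intro interpolation_coeffs_exist[OF assms(4)] inj_on_subset[OF assms(6)]) auto
    then obtain a where
      a: "\<And>N i. i < N \<Longrightarrow> (\<Sum>j<N. a N j * complex_of_real (k (x j) (x i))) = f (x i)"
      by atomize_elim (rule choice, blast)
    have "kernel_interpolation X HX ipX k x f a"
      by unfold_locales (simp_all add: x_mem kernel_comb_apply a)
    moreover have "interpolant k (x ` {..<N}) f = kernel_comb UNIV k x N (a N)" for N
      by (rule M.interpolant_eq_kernel_comb) (simp_all add: kernel_comb_apply a)
    ultimately show ?thesis
      using norm_eq by auto
  qed
  show ?thesis
  proof (intro conjI ballI allI impI)
    fix f assume f: "f \<in> HX"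
    obtain a where "kernel_interpolation X HX ipX k x f a" and norm:
        "\<And>N. ip_norm ip (interpolant k (x ` {..<N}) f) = ip_norm ipX (kernel_comb X k x N (a N))"
      using coeffs[of f] by blast
    then interpret kernel_interpolation X HX ipX k x f a by blast
    obtain g where "g \<in> HX" "\<And>n. g (x n) = f (x n)"
      and lim: "(\<lambda>N. ip_norm ipX (P N)) \<longlonglongrightarrow> ip_norm ipX g"
      using limit_exists[OF norm_le[OF f]] by blast
    then have "g = f"
      by (intro unique f)
    then show "(\<lambda>N. ip_norm ip (interpolant k (x ` {..<N}) f)) \<longlonglongrightarrow> ip_norm ipX f"
      using lim by (simp only: norm)
  next
    fix f
    assume nondiv: "\<not> filterlim (\<lambda>N. ip_norm ip (interpolant k (x ` {..<N}) f)) at_top sequentially"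
    obtain a where "kernel_interpolation X HX ipX k x f a" and norm:
        "\<And>N. ip_norm ip (interpolant k (x ` {..<N}) f) = ip_norm ipX (kernel_comb X k x N (a N))"
      using coeffs[of f] by blast
    then interpret kernel_interpolation X HX ipX k x f a by blast
    \<comment> \<open>The norms fall below \<open>B\<close> infinitely often; since they increase,
      \<open>B\<close> bounds them all.\<close>
    from nondiv obtain B where B: "\<not> (\<forall>\<^sub>F N in sequentially. B \<le> ip_norm ipX (P N))"
      unfolding norm filterlim_at_top by blast
    have "ip_norm ipX (P N) \<le> B" for N
    proof (rule ccontr)
      assume "\<not> ip_norm ipX (P N) \<le> B"
      then have "B \<le> ip_norm ipX (P M)" if "N \<le> M" for M
        using incseqD[OF norm_incseq that] by linarith
      then show False
        using B unfolding eventually_sequentially by blast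
    qed
    from limit_exists[OF this] obtain g where g: "g \<in> HX" "\<forall>n. g (x n) = f (x n)"
      by blast
    then show "\<exists>!g. g \<in> HX \<and> (\<forall>n. g (x n) = f (x n))"
    proof (intro ex1I conjI)
      fix h assume "h \<in> HX \<and> (\<forall>n. h (x n) = f (x n))"
      with g show "h = g"
        by (intro unique) simp_all
    qed
  qed
qed

end
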